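(* Suppose that for each $i\in I$ there are $\theta_i\in(0,1]$ and $H_i>0$ with $\|\nabla f_i(x)-\nabla f_i(y)\|\le H_i\|y-x\|^{\theta_i}$ for all $x,y\in\Omega$, and that there exists $f_i^*\in\mathbb{R}$ such that $f_i(x)\ge f_i^*$ for all $x\in\Omega$. Let $\{x_k\}_{k\ge0}$ and $\{\nu_k\}_{k\ge0}$ be generated by the Universal Nonmonotone Line Search Method, and suppose that $\{\nu_k\}_{k\ge0}$ is summable, i.e. $\sum_{k=0}^{+\infty}[\nu_k]_i<+\infty$ for all $i\in I$. Let $\theta_{\min}=\min_{i\in I}\theta_i$. Then the method takes no more than $\mathcal{O}\left(\epsilon^{-\left(1+\frac1{\theta_{\min}}\right)}\right)$ iterations to find an $\epsilon$-approximate Pareto critical point; that is, there is a constant $C>0$, depending only on $c_1,c_2,\beta,\rho$ and on $\theta_i$, $H_i$, $f_i(x_0)-f_i^*$, $\sum_{k=0}^{+\infty}[\nu_k]_i$ ($i\in I$), such that for every $\epsilon\in(0,1)$ and every $T$ with $\|s(x_k)\|>\epsilon$ for $k=0,\ldots,T-1$ one has $$T\le C\,\epsilon^{-\left(1+\frac1{\theta_{\min}}\right)}.$$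
   Context: Setting: $\emptyset\ne\Omega\subset\mathbb{R}^n$ is closed and convex, $F=(f_1,\ldots,f_m)^T:\mathbb{R}^n\to\mathbb{R}^m$ is continuously differentiable (possibly nonconvex), $I=\{1,\ldots,m\}$, $\|\cdot\|$ is the Euclidean norm, $\mathbb{R}^m_+=\{z\in\mathbb{R}^m: z_i\ge0,\ i\in I\}$. For $x\in\Omega$, $\Omega-x=\{y\in\mathbb{R}^n: y+x\in\Omega\}$, and $s(x)$ is the unique minimizer over $d\in\Omega-x$ of $\max_{i\in I}\{\nabla f_i(x)^Td\}+\frac12\|d\|^2$. A point $x\in\Omega$ is an $\epsilon$-approximate Pareto critical point when $\|s(x)\|\le\epsilon$. Universal Nonmonotone Line Search Method. Parameters: $x_0\in\Omega$, $m_0\in\{0,1,\ldots,m\}$, $c_1,c_2>0$, $\beta,\rho\in(0,1)$. At each iteration $k=0,1,2,\ldots$: (Step 1) choose $d(x_k)\in\Omega-x_k$ with $\max_{i\in I}\{\nabla f_i(x_k)^Td(x_k)\}\le-c_1\|s(x_k)\|^2$ and $\|d(x_k)\|\le c_2\|s(x_k)\|$. (Step 2) For $\ell=0,1,2,\ldots$ choose $\nu_{k,\ell}\in\mathbb{R}^m_+$ (arbitrarily), and let $\ell_k$ be the first $\ell$ for which both of the following hold: (i) the number of indices $i\in I$ with $f_i(x_k+\beta^\ell d(x_k))\le f_i(x_k)+\rho\beta^\ell\nabla f_i(x_k)^Td(x_k)$ is at least $m_k$; (ii) $f_i(x_k+\beta^\ell d(x_k))\le f_i(x_k)+\rho\beta^\ell\nabla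 f_i(x_k)^Td(x_k)+[\nu_{k,\ell}]_i$ for all $i\in I$. (Step 3) Set $\alpha_k=\beta^{\ell_k}$, $x_{k+1}=x_k+\alpha_kd(x_k)$, $\nu_k=\nu_{k,\ell_k}$, and choose $m_{k+1}\in\{0,1,\ldots,m\}$ (arbitrarily). *)

theory Defs
  imports "HOL-Analysis.Analysis"
begin

text \<open>
  The constant in the complexity bound must not depend on the dimension \<open>n\<close>, so \<open>n\<close> has to be
  quantified below the existential quantifier for that constant; this rules out the type
  \<open>real ^ 'n\<close>. Instead, \<open>\<real>\<^sup>n\<close> is the coordinate subspace spanned by the first \<open>n\<close> unit vectors of
  the inner product space of finitely supported real sequences.
\<close>

typedef finseq = "{x :: nat \<Rightarrow> real. finite {i. x i \<noteq> 0}}"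
  morphisms coord Abs_finseq
  by (rule exI[of _ "\<lambda>_. 0"]) simp

setup_lifting type_definition_finseq

lemma finite_coord [simp]: "finite {i. coord x i \<noteq> 0}"
  using coord[of x] by simp

lemma finseq_eqI: "(\<And>i. coord x i = coord y i) \<Longrightarrow> x = y"
  by (simp add: coord_inject[symmetric] fun_eq_iff)

instantiation finseq :: real_vector
begin

lift_definition zero_finseq :: finseq is "\<lambda>_. 0" by simp

lift_definition plus_finseq :: "finseq \<Rightarrow> finseq \<Rightarrow> finseq" is "\<lambda>x y i. x i + y i"
  subgoal for x y
    by (rule finite_subset[of _ "{i. x i \<noteq> 0} \<union> {i. y i \<noteq> 0}"]) auto
  done

lift_definition uminus_finseq :: "finseq \<Rightarrow> finseq" is "\<lambda>x i. - x i" by simp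

lift_definition minus_finseq :: "finseq \<Rightarrow> finseq \<Rightarrow> finseq" is "\<lambda>x y i. x i - y i"
  subgoal for x y
    by (rule finite_subset[of _ "{i. x i \<noteq> 0} \<union> {i. y i \<noteq> 0}"]) auto
  done

lift_definition scaleR_finseq :: "real \<Rightarrow> finseq \<Rightarrow> finseq" is "\<lambda>r x i. r * x i"
  by (erule rev_finite_subset) auto

instance
  by standard (transfer; simp add: algebra_simps fun_eq_iff)+

end

lemma coord_simps [simp]:
  "coord 0 i = 0"
  "coord (x + y) i = coord x i + coord y i"
  "coord (- x) i = - coord x i"
  "coord (x - y) i = coord x i - coord y i"
  "coord (r *\<^sub>R x) i = r * coord x i"
  by (transfer; simp)+

instantiation finseq :: real_inner
begin

definition inner_finseq :: "finseq \<Rightarrow> finseq \<Rightarrow> real" where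
  "inner_finseq x y = (\<Sum>i | coord x i \<noteq> 0. coord x i * coord y i)"

definition norm_finseq :: "finseq \<Rightarrow> real" where
  "norm_finseq x = sqrt (inner x x)"

definition dist_finseq :: "finseq \<Rightarrow> finseq \<Rightarrow> real" where
  "dist_finseq x y = norm (x - y)"

definition sgn_finseq :: "finseq \<Rightarrow> finseq" where
  "sgn_finseq x = x /\<^sub>R norm x"

definition uniformity_finseq :: "(finseq \<times> finseq) filter" where
  "uniformity_finseq = (INF e\<in>{0<..}. principal {(x, y). dist x y < e})"

definition open_finseq :: "finseq set \<Rightarrow> bool" where
  "open_finseq U \<longleftrightarrow> (\<forall>x\<in>U. \<forall>\<^sub>F (x', y) in uniformity. x' = x \<longrightarrow> y \<in> U)"

lemma inner_finseq_eq_sum: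
  assumes "finite A" "{i. coord x i \<noteq> 0} \<subseteq> A"
  shows "inner x y = (\<Sum>i\<in>A. coord x i * coord y i)"
  unfolding inner_finseq_def using assms by (intro sum.mono_neutral_left) auto

instance
proof
  fix x y z :: finseq and r :: real
  let ?A = "{i. coord x i \<noteq> 0} \<union> {i. coord y i \<noteq> 0}"
  have inner_A: "inner v w = (\<Sum>i\<in>?A. coord v i * coord w i)"
    if "{i. coord v i \<noteq> 0} \<subseteq> ?A" for v w
    using that by (intro inner_finseq_eq_sum) simp_all
  have x: "{i. coord x i \<noteq> 0} \<subseteq> ?A" and y: "{i. coord y i \<noteq> 0} \<subseteq> ?A"
    and xy: "{i. coord (x + y) i \<noteq> 0} \<subseteq> ?A" and rx: "{i. coord (r *\<^sub>R x) i \<noteq> 0} \<subseteq> ?A"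
    by auto
  show "inner x y = inner y x"
    unfolding inner_A[OF x] inner_A[OF y] by (simp add: mult.commute)
  show "inner (x + y) z = inner x z + inner y z"
    unfolding inner_A[OF x] inner_A[OF y] inner_A[OF xy]
    by (simp add: distrib_right sum.distrib)
  show "inner (r *\<^sub>R x) y = r * inner x y"
    unfolding inner_A[OF x] inner_A[OF rx] by (simp add: sum_distrib_left mult.assoc)
  show "0 \<le> inner x x"
    unfolding inner_finseq_def by (intro sum_nonneg) simp
  show "inner x x = 0 \<longleftrightarrow> x = 0"
    unfolding inner_finseq_def
    by (subst sum_nonneg_eq_0_iff) (auto intro!: finseq_eqI)
  show "norm x = sqrt (inner x x)" by (rule norm_finseq_def)
  show "dist x y = norm (x - y)" by (rule dist_finseq_def)
  show "sgn x = x /\<^sub>R norm x" by (rule sgn_finseq_def)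
  show "uniformity = (INF e\<in>{0<..}. principal {(x, y::finseq). dist x y < e})"
    by (rule uniformity_finseq_def)
  show "open U \<longleftrightarrow> (\<forall>x\<in>U. \<forall>\<^sub>F (x', y) in uniformity. x' = x \<longrightarrow> y \<in> U)" for U :: "finseq set"
    by (rule open_finseq_def)
qed

end

definition Rn :: "nat \<Rightarrow> finseq set" where
  "Rn n = {x. \<forall>i\<ge>n. coord x i = 0}"

lemma inner_Rn:
  assumes "x \<in> Rn n"
  shows "inner x y = (\<Sum>i<n. coord x i * coord y i)"
  using assms by (intro inner_finseq_eq_sum) (auto simp: Rn_def not_le[symmetric])

lemma norm_Rn:
  assumes "x \<in> Rn n"
  shows "norm x = sqrt (\<Sum>i<n. (coord x i)\<^sup>2)"
  using inner_Rn[OF assms, of x] by (simp add: norm_finseq_def power2_eq_square)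

lemma Rn_coordinates:
  "\<exists>!x. x \<in> Rn n \<and> (\<forall>i<n. coord x i = v i)"
proof
  have "finite {i. (if i < n then v i else 0) \<noteq> 0}"
    by (rule finite_subset[of _ "{..<n}"]) auto
  then show "Abs_finseq (\<lambda>i. if i < n then v i else 0) \<in> Rn n \<and>
      (\<forall>i<n. coord (Abs_finseq (\<lambda>i. if i < n then v i else 0)) i = v i)"
    by (simp add: Rn_def Abs_finseq_inverse)
  then have "coord x i = coord (Abs_finseq (\<lambda>i. if i < n then v i else 0)) i"
    if "x \<in> Rn n \<and> (\<forall>i<n. coord x i = v i)" for x i
    using that by (cases "i < n") (simp_all add: Rn_def)
  then show "x = Abs_finseq (\<lambda>i. if i < n then v i else 0)"
    if "x \<in> Rn n \<and> (\<forall>i<n. coord x i = v i)" for x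
    using that by (intro finseq_eqI)
qed

text \<open>
  \<open>F : \<real>\<^sup>n \<rightarrow> \<real>\<^sup>m\<close> is continuously differentiable and \<open>G x $ i\<close> is the gradient of its \<open>i\<close>-th
  component at \<open>x\<close>. Differentiating within \<open>Rn n\<close>, together with \<open>G x $ i \<in> Rn n\<close>, makes \<open>G x\<close>
  unique for \<open>x \<in> Rn n\<close>; values of \<open>F\<close> outside \<open>Rn n\<close> play no role.
\<close>

definition C1_with_gradients ::
  "nat \<Rightarrow> (finseq \<Rightarrow> real ^ 'm::finite) \<Rightarrow> (finseq \<Rightarrow> finseq ^ 'm) \<Rightarrow> bool" where
  "C1_with_gradients n F G \<longleftrightarrow>
     (\<forall>x\<in>Rn n. \<forall>i. G x $ i \<in> Rn n \<and>
        ((\<lambda>y. F y $ i) has_derivative (\<lambda>h. G x $ i \<bullet> h)) (at x within Rn n)) \<and>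
     continuous_on (Rn n) G"

definition s_dir :: "'a::real_inner set \<Rightarrow> ('a \<Rightarrow> 'a ^ 'm::finite) \<Rightarrow> 'a \<Rightarrow> 'a" where
  "s_dir \<Omega> G x =
     (THE d. is_arg_min (\<lambda>d. (MAX i. G x $ i \<bullet> d) + (norm d)\<^sup>2 / 2) (\<lambda>d. d + x \<in> \<Omega>) d)"

definition acceptable_step ::
  "('a::real_inner \<Rightarrow> real ^ 'm::finite) \<Rightarrow> ('a \<Rightarrow> 'a ^ 'm) \<Rightarrow> real \<Rightarrow> 'a \<Rightarrow> 'a \<Rightarrow>
     nat \<Rightarrow> real ^ 'm \<Rightarrow> real \<Rightarrow> bool" where
  "acceptable_step F G \<rho> x d q \<nu> a \<longleftrightarrow>
     q \<le> card {i. F (x + a *\<^sub>R d) $ i \<le> F x $ i + \<rho> * a * (G x $ i \<bullet> d)} \<and>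
     (\<forall>i. F (x + a *\<^sub>R d) $ i \<le> F x $ i + \<rho> * a * (G x $ i \<bullet> d) + \<nu> $ i)"

text \<open>
  The sequences are: iterates \<open>x\<close>, directions \<open>d\<close>, required numbers of monotone components \<open>q\<close>
  (written \<open>m\<^sub>k\<close> informally), trial relaxations \<open>\<nu> k l\<close>, and accepted backtracking
  exponents \<open>ell\<close>; \<open>\<nu> k (ell k)\<close> is the relaxation used at iteration \<open>k\<close>. Trial values \<open>\<nu> k l\<close>
  with \<open>l > ell k\<close> are never used.
\<close>

definition nonmonotone_line_search ::
  "'a::real_inner set \<Rightarrow> ('a \<Rightarrow> real ^ 'm::finite) \<Rightarrow> ('a \<Rightarrow> 'a ^ 'm) \<Rightarrow>
     real \<Rightarrow> real \<Rightarrow> real \<Rightarrow> real \<Rightarrow>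
     (nat \<Rightarrow> 'a) \<Rightarrow> (nat \<Rightarrow> 'a) \<Rightarrow> (nat \<Rightarrow> nat) \<Rightarrow> (nat \<Rightarrow> nat \<Rightarrow> real ^ 'm) \<Rightarrow> (nat \<Rightarrow> nat) \<Rightarrow> bool" where
  "nonmonotone_line_search \<Omega> F G c1 c2 \<beta> \<rho> x d q \<nu> ell \<longleftrightarrow>
     x 0 \<in> \<Omega> \<and>
     (\<forall>k. q k \<le> CARD('m)) \<and>
     (\<forall>k. d k + x k \<in> \<Omega> \<and>
          (MAX i. G (x k) $ i \<bullet> d k) \<le> - c1 * (norm (s_dir \<Omega> G (x k)))\<^sup>2 \<and>
          norm (d k) \<le> c2 * norm (s_dir \<Omega> G (x k))) \<and>
     (\<forall>k l i. 0 \<le> \<nu> k l $ i) \<and>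
     (\<forall>k. ell k = (LEAST l. acceptable_step F G \<rho> (x k) (d k) (q k) (\<nu> k l) (\<beta> ^ l))) \<and>
     (\<forall>k. x (Suc k) = x k + \<beta> ^ ell k *\<^sub>R d k)"

end

theory Submission
  imports Defs
begin

text \<open>
  By the mean value theorem and Hoelder continuity, \<open>f\<^sub>i (x + a d) \<le> f\<^sub>i x + a \<nabla>f\<^sub>i(x)\<^sup>T d +
  H\<^sub>i (a \<parallel>d\<parallel>)\<^bsup>1 + \<theta>\<^sub>i\<^esup>\<close>. With \<open>\<nabla>f\<^sub>i(x)\<^sup>T d \<le> - c\<^sub>1 \<parallel>s(x)\<parallel>\<^sup>2\<close>, \<open>\<parallel>d\<parallel> \<le> c\<^sub>2 \<parallel>s(x)\<parallel>\<close> and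
  \<open>\<epsilon> < \<parallel>s(x)\<parallel>\<close>, every component meets the Armijo condition once \<open>a \<le> K \<epsilon>\<^bsup>1/\<theta>\<^sub>m\<^sub>i\<^sub>n - 1\<^esup>\<close>, whatever
  relaxations are tried. Hence accepted steps are at least a constant times \<open>\<epsilon>\<^bsup>1/\<theta>\<^sub>m\<^sub>i\<^sub>n - 1\<^esup>\<close>, and
  each iteration lowers any fixed component by a constant times \<open>\<epsilon>\<^bsup>1/\<theta>\<^sub>m\<^sub>i\<^sub>n + 1\<^esup>\<close>, up to a summable
  error. Summing over the iterations bounds their number.
\<close>

section \<open>Descent along a segment for Hoelder gradients\<close>

text \<open>Convexity keeps the segment in \<open>\<Omega>\<close>, so the mean value theorem
  applies to the restriction of \<open>f\<close> to it. Moving the gradient from the intermediate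
  point back to \<open>x\<close> costs the Hoelder term.\<close>

lemma holder_gradient_descent:
  fixes f :: "'a::real_inner \<Rightarrow> real"
  assumes "convex \<Omega>" "x \<in> \<Omega>" "x + d \<in> \<Omega>" "0 \<le> a" "a \<le> 1" "0 \<le> \<theta>" "0 \<le> H"
    and deriv: "\<And>y. y \<in> \<Omega> \<Longrightarrow> (f has_derivative (\<lambda>h. g y \<bullet> h)) (at y within \<Omega>)"
    and holder: "\<And>y z. y \<in> \<Omega> \<Longrightarrow> z \<in> \<Omega> \<Longrightarrow> norm (g y - g z) \<le> H * norm (z - y) powr \<theta>"
  shows "f (x + a *\<^sub>R d) \<le> f x + a * (g x \<bullet> d) + H * (a * norm d) powr (1 + \<theta>)"
proof -
  have seg: "x + t *\<^sub>R d \<in> \<Omega>" if "0 \<le> t" "t \<le> 1" for t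
    using convexD_alt[OF assms(1-3) that] by (simp add: algebra_simps)
  have "\<exists>t\<in>{0..a}. f (x + a *\<^sub>R d) - f (x + 0 *\<^sub>R d) = g (x + t *\<^sub>R d) \<bullet> ((a - 0) *\<^sub>R d)"
  proof (rule mvt_very_simple)
    show "((\<lambda>t. f (x + t *\<^sub>R d)) has_derivative (\<lambda>h. g (x + t *\<^sub>R d) \<bullet> (h *\<^sub>R d)))
        (at t within {0..a})" if "0 \<le> t" "t \<le> a" for t
    proof (rule has_derivative_in_compose[where f = "\<lambda>t. x + t *\<^sub>R d"])
      show "((\<lambda>t. x + t *\<^sub>R d) has_derivative (\<lambda>h. h *\<^sub>R d)) (at t within {0..a})"
        by (auto intro!: derivative_eq_intros)
      show "(f has_derivative (\<lambda>h. g (x + t *\<^sub>R d) \<bullet> h))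
          (at (x + t *\<^sub>R d) within (\<lambda>t. x + t *\<^sub>R d) ` {0..a})"
        using seg that \<open>a \<le> 1\<close> by (intro has_derivative_subset[OF deriv]) auto
    qed
  qed fact
  then obtain t where t: "0 \<le> t" "t \<le> a"
    and eq: "f (x + a *\<^sub>R d) - f x = a * (g (x + t *\<^sub>R d) \<bullet> d)"
    by auto
  have "norm (g (x + t *\<^sub>R d) - g x) \<le> H * norm (x - (x + t *\<^sub>R d)) powr \<theta>"
    using seg t assms by (intro holder) auto
  also have "\<dots> \<le> H * (a * norm d) powr \<theta>"
    using t assms by (intro mult_left_mono powr_mono2) (auto intro: mult_right_mono)
  finally have diff: "norm (g (x + t *\<^sub>R d) - g x) \<le> H * (a * norm d) powr \<theta>" .
  have "a * (g (x + t *\<^sub>R d) \<bullet> d) = a * (g x \<bullet> d) + a * ((g (x + t *\<^sub>R d) - g x) \<bullet> d)"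
    by (simp add: inner_diff_left algebra_simps)
  also have "a * ((g (x + t *\<^sub>R d) - g x) \<bullet> d) \<le> a * (norm (g (x + t *\<^sub>R d) - g x) * norm d)"
    using \<open>0 \<le> a\<close> by (intro mult_left_mono norm_cauchy_schwarz)
  also have "\<dots> \<le> a * (H * (a * norm d) powr \<theta> * norm d)"
    using \<open>0 \<le> a\<close> diff by (intro mult_left_mono mult_right_mono) auto
  also have "\<dots> = H * (a * norm d) powr (1 + \<theta>)"
    using \<open>0 \<le> a\<close> by (simp add: powr_mult_base[symmetric])
  finally show ?thesis
    using eq by simp
qed

text \<open>
  The positive root \<open>a\<close> of \<open>H (a c\<^sub>2 s)\<^bsup>1 + \<theta>\<^esup> = (1 - \<rho>) a c\<^sub>1 s\<^sup>2\<close> is this threshold times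
  \<open>s\<^bsup>1/\<theta> - 1\<^esup>\<close>.
\<close>

definition armijo_threshold :: "real \<Rightarrow> real \<Rightarrow> real \<Rightarrow> real \<Rightarrow> real \<Rightarrow> real" where
  "armijo_threshold c1 c2 \<rho> \<theta> H = ((1 - \<rho>) * c1 / (H * c2 powr (1 + \<theta>))) powr (1 / \<theta>)"

lemma armijo_threshold_pos:
  assumes "0 < c1" "0 < c2" "\<rho> < 1" "0 < H"
  shows "0 < armijo_threshold c1 c2 \<rho> \<theta> H"
  using assms by (simp add: armijo_threshold_def)

text \<open>For \<open>a\<close> below the threshold, the Hoelder remainder uses up at most the
  fraction \<open>1 - \<rho>\<close> of the linear decrease; the fraction \<open>\<rho>\<close> that
  is left is the Armijo decrease.\<close>

lemma armijo_holder:
  fixes f :: "'a::real_inner \<Rightarrow> real"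
  assumes "convex \<Omega>" "x \<in> \<Omega>" "x + d \<in> \<Omega>" "0 < a" "a \<le> 1" "0 < \<theta>" "0 < H"
    and deriv: "\<And>y. y \<in> \<Omega> \<Longrightarrow> (f has_derivative (\<lambda>h. g y \<bullet> h)) (at y within \<Omega>)"
    and holder: "\<And>y z. y \<in> \<Omega> \<Longrightarrow> z \<in> \<Omega> \<Longrightarrow> norm (g y - g z) \<le> H * norm (z - y) powr \<theta>"
    and pos: "0 < c1" "0 < c2" "\<rho> < 1" "0 < s"
    and slope: "g x \<bullet> d \<le> - c1 * s\<^sup>2" and "norm d \<le> c2 * s"
    and a: "a \<le> armijo_threshold c1 c2 \<rho> \<theta> H * s powr (1 / \<theta> - 1)"
  shows "f (x + a *\<^sub>R d) \<le> f x + \<rho> * a * (g x \<bullet> d)"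
proof -
  let ?\<kappa> = "(1 - \<rho>) * c1 / (H * c2 powr (1 + \<theta>))"
  have "a powr \<theta> \<le> (?\<kappa> powr (1 / \<theta>) * s powr (1 / \<theta> - 1)) powr \<theta>"
    using a assms unfolding armijo_threshold_def by (intro powr_mono2) auto
  also have "\<dots> = ?\<kappa> * s powr (1 - \<theta>)"
    using assms by (simp add: powr_mult powr_powr left_diff_distrib)
  finally have a\<theta>: "a powr \<theta> \<le> ?\<kappa> * s powr (1 - \<theta>)" .
  have "H * (a * norm d) powr (1 + \<theta>) \<le> H * (a * (c2 * s)) powr (1 + \<theta>)"
    using assms by (intro mult_left_mono powr_mono2) auto
  \<comment> \<open>Only \<open>a powr \<theta>\<close> is traded for the threshold; the other
    factor \<open>a\<close> is kept to match the linear term.\<close>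
  also have "\<dots> = a * (H * c2 powr (1 + \<theta>) * s powr (1 + \<theta>)) * a powr \<theta>"
    using assms by (simp add: powr_mult powr_add)
  also have "\<dots> \<le> a * (H * c2 powr (1 + \<theta>) * s powr (1 + \<theta>)) * (?\<kappa> * s powr (1 - \<theta>))"
    using assms a\<theta> by (intro mult_left_mono) auto
  also have "\<dots> = a * ((1 - \<rho>) * c1) * (s powr (1 + \<theta>) * s powr (1 - \<theta>))"
    using assms by (simp add: field_simps)
  also have "s powr (1 + \<theta>) * s powr (1 - \<theta>) = s\<^sup>2"
    using \<open>0 < s\<close> by (simp flip: powr_add)
  also have "a * ((1 - \<rho>) * c1) * s\<^sup>2 = a * (1 - \<rho>) * (c1 * s\<^sup>2)"
    by simp
  also have "\<dots> \<le> a * (1 - \<rho>) * (- (g x \<bullet> d))"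
    using assms by (intro mult_left_mono) auto
  finally have "H * (a * norm d) powr (1 + \<theta>) \<le> a * (1 - \<rho>) * (- (g x \<bullet> d))" .
  moreover have "f (x + a *\<^sub>R d) \<le> f x + a * (g x \<bullet> d) + H * (a * norm d) powr (1 + \<theta>)"
    using assms by (intro holder_gradient_descent[OF assms(1-3)]) auto
  ultimately show ?thesis
    by (simp add: algebra_simps)
qed

section \<open>Backtracking and acceptance of trial steps\<close>

text \<open>Either the first trial \<open>\<beta> ^ 0 = 1\<close> is accepted, or the trial just
  before the accepted one failed; its step then exceeded \<open>\<tau>\<close>, and one more factor
  \<open>\<beta>\<close> gives the bound.\<close>

lemma backtracking_Least:
  fixes \<beta> \<tau> :: real
  assumes "0 < \<beta>" "\<beta> < 1" "0 < \<tau>" and P: "\<And>l. \<beta> ^ l \<le> \<tau> \<Longrightarrow> P l"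
  shows "P (LEAST l. P l)" and "min 1 (\<beta> * \<tau>) \<le> \<beta> ^ (LEAST l. P l)"
proof -
  obtain l where "\<beta> ^ l < \<tau>"
    using real_arch_pow_inv[OF \<open>0 < \<tau>\<close> \<open>\<beta> < 1\<close>] by auto
  with P[of l] show "P (LEAST l. P l)"
    by (intro LeastI[of P l]) simp
  show "min 1 (\<beta> * \<tau>) \<le> \<beta> ^ (LEAST l. P l)"
  proof (cases "LEAST l. P l")
    case (Suc l)
    then have "\<not> P l"
      using not_less_Least[of l P] by simp
    with P[of l] have "\<tau> < \<beta> ^ l"
      by (cases "\<beta> ^ l \<le> \<tau>") auto
    then show ?thesis
      using Suc \<open>0 < \<beta>\<close> by (simp add: min_le_iff_disj)
  qed simp
qed

text \<open>Armijo in all components makes the count equal to \<open>CARD('m)\<close>, and a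
  nonnegative relaxation only weakens the test, so the free choices of \<open>q\<close> and
  \<open>\<nu>\<close> cannot prevent acceptance.\<close>

lemma acceptable_stepI:
  fixes F :: "'a::real_inner \<Rightarrow> real ^ 'm::finite"
  assumes "\<And>i. F (x + a *\<^sub>R d) $ i \<le> F x $ i + \<rho> * a * (G x $ i \<bullet> d)"
    and "q \<le> CARD('m)" "\<And>i. 0 \<le> \<nu> $ i"
  shows "acceptable_step F G \<rho> x d q \<nu> a"
  using assms by (simp add: acceptable_step_def add_increasing2)

section \<open>Feasibility and decrease along the iterates\<close>

lemma nonmonotone_line_search_mem:
  assumes "nonmonotone_line_search \<Omega> F G c1 c2 \<beta> \<rho> x d q \<nu> ell"
    and "convex \<Omega>" "0 \<le> \<beta>" "\<beta> \<le> 1"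
  shows "x k \<in> \<Omega>"
proof (induction k)
  case 0
  show ?case
    using assms by (simp add: nonmonotone_line_search_def)
next
  case (Suc k)
  have d: "d k + x k \<in> \<Omega>" and step: "x (Suc k) = x k + \<beta> ^ ell k *\<^sub>R d k"
    using assms(1) by (auto simp: nonmonotone_line_search_def)
  have "(1 - \<beta> ^ ell k) *\<^sub>R x k + \<beta> ^ ell k *\<^sub>R (d k + x k) \<in> \<Omega>"
    using assms by (intro convexD_alt Suc d) (auto intro: power_le_one)
  then show ?case
    by (simp add: step algebra_simps)
qed

text \<open>\<open>p\<close> and \<open>K\<close> are uniform over the components, so one step
  threshold serves all of them. A step of order at least \<open>\<epsilon> powr (p - 1)\<close> and
  a squared norm above \<open>\<epsilon>\<^sup>2\<close> combine to the exponent
  \<open>1 + p\<close>.\<close>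

lemma nonmonotone_line_search_step:
  fixes F :: "'a::real_inner \<Rightarrow> real ^ 'm::finite" and \<theta> H :: "real ^ 'm"
  assumes pos: "0 < c1" "0 < c2" "0 < \<beta>" "\<beta> < 1" "0 < \<rho>" "\<rho> < 1"
    and \<theta>: "\<And>i. 0 < \<theta> $ i \<and> \<theta> $ i \<le> 1" and H: "\<And>i. 0 < H $ i"
    and p: "\<And>i. 1 / \<theta> $ i \<le> p"
    and K: "0 < K" "\<And>i. K \<le> armijo_threshold c1 c2 \<rho> (\<theta> $ i) (H $ i)"
    and "convex \<Omega>"
    and deriv: "\<And>y i. y \<in> \<Omega> \<Longrightarrow>
      ((\<lambda>y. F y $ i) has_derivative (\<lambda>h. G y $ i \<bullet> h)) (at y within \<Omega>)"
    and holder: "\<And>y z i. y \<in> \<Omega> \<Longrightarrow> z \<in> \<Omega> \<Longrightarrow>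
      norm (G y $ i - G z $ i) \<le> H $ i * norm (z - y) powr (\<theta> $ i)"
    and alg: "nonmonotone_line_search \<Omega> F G c1 c2 \<beta> \<rho> x d q \<nu> ell"
    and \<epsilon>: "0 < \<epsilon>" "\<epsilon> < 1" "\<epsilon> < norm (s_dir \<Omega> G (x k))"
  shows "F (x (Suc k)) $ i \<le>
    F (x k) $ i - \<rho> * c1 * min 1 (\<beta> * K) * \<epsilon> powr (1 + p) + \<nu> k (ell k) $ i"
proof -
  define s where "s = norm (s_dir \<Omega> G (x k))"
  have s: "\<epsilon> < s"
    using \<epsilon> by (simp add: s_def)
  have dk: "d k + x k \<in> \<Omega>" "norm (d k) \<le> c2 * s" "(MAX i. G (x k) $ i \<bullet> d k) \<le> - c1 * s\<^sup>2"
    and q: "q k \<le> CARD('m)" and \<nu>: "\<And>l i. 0 \<le> \<nu> k l $ i"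
    and ell: "ell k = (LEAST l. acceptable_step F G \<rho> (x k) (d k) (q k) (\<nu> k l) (\<beta> ^ l))"
    and step: "x (Suc k) = x k + \<beta> ^ ell k *\<^sub>R d k"
    using alg by (auto simp: nonmonotone_line_search_def s_def)
  have xk: "x k \<in> \<Omega>"
    using pos by (intro nonmonotone_line_search_mem[OF alg \<open>convex \<Omega>\<close>]) auto
  have slope: "G (x k) $ j \<bullet> d k \<le> - c1 * s\<^sup>2" for j
    using dk(3) by (rule order_trans[rotated]) (simp add: Max_ge)
  let ?\<tau> = "K * \<epsilon> powr (p - 1)"
  have acc: "acceptable_step F G \<rho> (x k) (d k) (q k) (\<nu> k l) (\<beta> ^ l)" if l: "\<beta> ^ l \<le> ?\<tau>" for l
  proof (rule acceptable_stepI[OF _ q \<nu>])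
    fix j
    \<comment> \<open>The first bound uses \<open>\<epsilon> < 1\<close>; the second uses
      \<open>\<theta> $ j \<le> 1\<close>, which makes the exponent nonnegative.\<close>
    have "\<epsilon> powr (p - 1) \<le> \<epsilon> powr (1 / \<theta> $ j - 1)"
      using \<epsilon> p[of j] by (intro powr_mono') auto
    also have "\<dots> \<le> s powr (1 / \<theta> $ j - 1)"
      using \<epsilon> s \<theta>[of j] by (intro powr_mono2) auto
    finally have "?\<tau> \<le> armijo_threshold c1 c2 \<rho> (\<theta> $ j) (H $ j) * s powr (1 / \<theta> $ j - 1)"
      using K(1) K(2)[of j] by (intro mult_mono) auto
    with l show "F (x k + \<beta> ^ l *\<^sub>R d k) $ j
        \<le> F (x k) $ j + \<rho> * \<beta> ^ l * (G (x k) $ j \<bullet> d k)"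
      using pos \<epsilon> s \<theta>[of j] H[of j] dk xk slope[of j]
      by (intro armijo_holder[OF \<open>convex \<Omega>\<close> xk, where g = "\<lambda>y. G y $ j" and s = s
            and \<theta> = "\<theta> $ j" and H = "H $ j" and ?c1.0 = c1 and ?c2.0 = c2] deriv holder)
        (auto simp: add.commute intro: power_le_one)
  qed
  have \<tau>: "0 < ?\<tau>"
    using \<epsilon> K by simp
  note least = backtracking_Least[OF pos(3,4) \<tau>,
      where P = "\<lambda>l. acceptable_step F G \<rho> (x k) (d k) (q k) (\<nu> k l) (\<beta> ^ l)", OF acc]
  \<comment> \<open>Hence \<open>p\<close> is at least 1, and the factor
    \<open>\<epsilon> powr (p - 1)\<close>, being at most 1, can be moved inside the
    minimum.\<close>
  have "1 \<le> 1 / \<theta> $ i"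
    using \<theta>[of i] by simp
  with p[of i] have "\<epsilon> powr (p - 1) \<le> 1"
    using \<epsilon> by (intro powr_le1) auto
  then have "min 1 (\<beta> * K) * \<epsilon> powr (p - 1) \<le> min 1 (\<beta> * ?\<tau>)"
    using \<epsilon> pos K by (auto simp: min_def mult.assoc intro: mult_le_one mult_right_mono order_trans)
  also have "\<dots> \<le> \<beta> ^ ell k"
    using least(2) by (simp add: ell)
  finally have "min 1 (\<beta> * K) * \<epsilon> powr (p - 1) * \<epsilon>\<^sup>2 \<le> \<beta> ^ ell k * s\<^sup>2"
    using \<epsilon> s pos K by (intro mult_mono power_mono) auto
  moreover have "\<epsilon> powr (p - 1) * \<epsilon>\<^sup>2 = \<epsilon> powr (1 + p)"
    using \<epsilon> by (simp add: powr_add[symmetric] flip: powr_numeral)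
  ultimately have "min 1 (\<beta> * K) * \<epsilon> powr (1 + p) \<le> \<beta> ^ ell k * s\<^sup>2"
    by (simp add: mult.assoc)
  then have "\<rho> * c1 * (min 1 (\<beta> * K) * \<epsilon> powr (1 + p)) \<le> \<rho> * c1 * (\<beta> ^ ell k * s\<^sup>2)"
    using pos by (intro mult_left_mono) auto
  moreover have "\<rho> * \<beta> ^ ell k * (G (x k) $ i \<bullet> d k) \<le> \<rho> * \<beta> ^ ell k * (- c1 * s\<^sup>2)"
    using pos by (intro mult_left_mono slope) auto
  moreover have "F (x (Suc k)) $ i \<le>
      F (x k) $ i + \<rho> * \<beta> ^ ell k * (G (x k) $ i \<bullet> d k) + \<nu> k (ell k) $ i"
    using least(1) unfolding ell[symmetric] by (simp add: acceptable_step_def step)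
  ultimately show ?thesis
    by (simp add: algebra_simps)
qed

section \<open>Summation over the iterations\<close>

lemma nearly_decreasing_bound:
  fixes f \<nu> :: "nat \<Rightarrow> real"
  assumes "\<And>k. k < T \<Longrightarrow> f (Suc k) \<le> f k - \<delta> + \<nu> k"
  shows "real T * \<delta> \<le> f 0 - f T + (\<Sum>k<T. \<nu> k)"
  using assms
proof (induction T)
  case (Suc T)
  from Suc.IH Suc.prems have "real T * \<delta> \<le> f 0 - f T + (\<Sum>k<T. \<nu> k)"
    by simp
  with Suc.prems[of T] show ?case
    by (simp add: algebra_simps)
qed simp

theorem mainTheorem3:
  fixes c1 c2 \<beta> \<rho> :: real
    and \<theta> H \<Delta> \<sigma> :: "real ^ 'm::finite"
  assumes "0 < c1" "0 < c2" "0 < \<beta>" "\<beta> < 1" "0 < \<rho>" "\<rho> < 1"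
    and "\<And>i. 0 < \<theta> $ i \<and> \<theta> $ i \<le> 1"
    and "\<And>i. 0 < H $ i"
  shows "\<exists>C>0. \<forall>n (\<Omega> :: finseq set) (F :: finseq \<Rightarrow> real ^ 'm) (G :: finseq \<Rightarrow> finseq ^ 'm)
      (fstar :: real ^ 'm) x d q \<nu> ell.
    \<Omega> \<subseteq> Rn n \<and> \<Omega> \<noteq> {} \<and> closed \<Omega> \<and> convex \<Omega> \<and>
    C1_with_gradients n F G \<and>
    (\<forall>i. \<forall>y\<in>\<Omega>. \<forall>z\<in>\<Omega>. norm (G y $ i - G z $ i) \<le> H $ i * norm (z - y) powr (\<theta> $ i)) \<and>
    (\<forall>i. \<forall>y\<in>\<Omega>. fstar $ i \<le> F y $ i) \<and>
    nonmonotone_line_search \<Omega> F G c1 c2 \<beta> \<rho> x d q \<nu> ell \<and>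
    (\<forall>i. \<Delta> $ i = F (x 0) $ i - fstar $ i) \<and>
    (\<forall>i. (\<lambda>k. \<nu> k (ell k) $ i) sums (\<sigma> $ i))
    \<longrightarrow> (\<forall>\<epsilon> T. 0 < \<epsilon> \<and> \<epsilon> < 1 \<and> (\<forall>k<T. \<epsilon> < norm (s_dir \<Omega> G (x k))) \<longrightarrow>
          real T \<le> C * \<epsilon> powr (- (1 + 1 / (MIN i. \<theta> $ i))))"
proof -
  define K where "K = (MIN i. armijo_threshold c1 c2 \<rho> (\<theta> $ i) (H $ i))"
  define p where "p = 1 / (MIN i. \<theta> $ i)"
  define c where "c = \<rho> * c1 * min 1 (\<beta> * K)"
  \<comment> \<open>The decrease estimate holds in every component, so any fixed index will
    do.\<close>
  define i :: 'm where "i = undefined"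
  \<comment> \<open>\<open>\<Delta>\<close> and \<open>\<sigma>\<close> are fixed before any run of
    the method, so their signs are unknown here; absolute values and the summand 1 make
    \<open>C\<close> positive.\<close>
  define C where "C = (\<bar>\<Delta> $ i\<bar> + \<bar>\<sigma> $ i\<bar> + 1) / c"
  have K_le: "K \<le> armijo_threshold c1 c2 \<rho> (\<theta> $ j) (H $ j)" for j
    by (simp add: K_def)
  have "0 < K"
    unfolding K_def using assms by (subst Min_gr_iff) (auto intro: armijo_threshold_pos)
  then have "0 < c"
    using assms by (simp add: c_def)
  have "0 < (MIN j. \<theta> $ j)"
    using assms by (subst Min_gr_iff) auto
  then have p: "1 / \<theta> $ j \<le> p" for j
    unfolding p_def by (intro divide_left_mono) (use assms in auto)
  show ?thesis
    unfolding p_def[symmetric]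
  proof (intro exI[of _ C] conjI allI impI, goal_cases)
    case 1
    show ?case
      using \<open>0 < c\<close> by (simp add: C_def add_nonneg_pos)
  next
    case (2 n \<Omega> F G fstar x d q \<nu> ell \<epsilon> T)
    then have \<Omega>: "\<Omega> \<subseteq> Rn n" "convex \<Omega>" and C1: "C1_with_gradients n F G"
      and holder: "\<And>j y z. y \<in> \<Omega> \<Longrightarrow> z \<in> \<Omega> \<Longrightarrow>
        norm (G y $ j - G z $ j) \<le> H $ j * norm (z - y) powr (\<theta> $ j)"
      and lower: "\<And>y. y \<in> \<Omega> \<Longrightarrow> fstar $ i \<le> F y $ i"
      and alg: "nonmonotone_line_search \<Omega> F G c1 c2 \<beta> \<rho> x d q \<nu> ell"
      and \<Delta>: "\<Delta> $ i = F (x 0) $ i - fstar $ i"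
      and \<sigma>: "(\<lambda>k. \<nu> k (ell k) $ i) sums (\<sigma> $ i)"
      and \<epsilon>: "0 < \<epsilon>" "\<epsilon> < 1" "\<And>k. k < T \<Longrightarrow> \<epsilon> < norm (s_dir \<Omega> G (x k))"
      by auto
    have deriv: "((\<lambda>y. F y $ j) has_derivative (\<lambda>h. G y $ j \<bullet> h)) (at y within \<Omega>)"
      if "y \<in> \<Omega>" for y j
      using C1 \<Omega>(1) that by (auto simp: C1_with_gradients_def intro: has_derivative_subset)
    have "F (x (Suc k)) $ i \<le> F (x k) $ i - c * \<epsilon> powr (1 + p) + \<nu> k (ell k) $ i" if "k < T" for k
      unfolding c_def using \<epsilon> that
      by (intro nonmonotone_line_search_step[OF assms p \<open>0 < K\<close> K_le \<Omega>(2) deriv holder alg])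
    then have "real T * (c * \<epsilon> powr (1 + p))
        \<le> F (x 0) $ i - F (x T) $ i + (\<Sum>k<T. \<nu> k (ell k) $ i)"
      by (rule nearly_decreasing_bound[where f = "\<lambda>k. F (x k) $ i"])
    \<comment> \<open>Relaxations are nonnegative, so the total bounds every partial sum.\<close>
    also have "(\<Sum>k<T. \<nu> k (ell k) $ i) \<le> \<sigma> $ i"
      using \<sigma> alg unfolding sums_iff nonmonotone_line_search_def
      by (metis (no_types, lifting) finite_lessThan sum_le_suminf)
    finally have "real T * (c * \<epsilon> powr (1 + p)) \<le> F (x 0) $ i - F (x T) $ i + \<sigma> $ i"
      by simp
    \<comment> \<open>Every iterate is feasible, so the lower bound also covers \<open>x T\<close>,
      whose \<open>s_dir\<close> is not assumed to exceed \<open>\<epsilon>\<close>.\<close>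
    moreover have "fstar $ i \<le> F (x T) $ i"
      using assms by (intro lower nonmonotone_line_search_mem[OF alg \<Omega>(2)]) auto
    ultimately have "real T * (c * \<epsilon> powr (1 + p)) \<le> \<bar>\<Delta> $ i\<bar> + \<bar>\<sigma> $ i\<bar> + 1"
      using \<Delta> by linarith
    then show ?case
      using \<open>0 < c\<close> \<epsilon>(1) unfolding C_def powr_minus by (simp add: field_simps)
  qed
qed

end
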